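(* Let $N=1$, let $\mathscr{R}=\{\alpha,-\alpha\}\subset\mathbb{R}$ with $\alpha\in\mathbb{R}_{>0}$, and let $k$ be a non-negative multiplicity function on $\mathscr{R}$, identified with the number $k=k_\alpha=k_{-\alpha}\in\mathbb{R}_{\ge0}$. Then, for $z\in\mathbb{C}$ with $\operatorname{Re}z>0$, the integral kernel $K_k$ of $\exp(z|x|^2\Delta_k)$ satisfies $$K_k(x,x';z)=\frac{1}{2\alpha^{2k}\sqrt{4\pi z}}\exp\Bigl(-\frac{(\log|x|-\log|x'|)^2}{4z}\Bigr)|xx'|^{-k+\frac12}\Bigl(e^{-(k-\frac12)^2z}+e^{-(k+\frac12)^2z}\operatorname{sgn}(xx')\Bigr)$$ for all $x,x'\in\mathbb{R}\setminus\{0\}$. In particular, when $k=0$, $$K_0(x,x';z)=\frac{e^{-\frac z4}}{2\sqrt{4\pi z}}\exp\Bigl(-\frac{(\log|x|-\log|x'|)^2}{4z}\Bigr)|xx'|^{\frac12}\bigl(1+\operatorname{sgn}(xx')\bigr)$$ for all $x,x'\in\mathbb{R}\setminus\{0\}$.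
   Context: The branch of $\sqrt z$ is such that $\sqrt z>0$ when $z>0$. Here $\langle k\rangle=k$, and the Dunkl Laplacian is $\Delta_kF(x)=F''(x)+k\bigl(\frac{2F'(x)}{x}-\frac{F(x)-F(-x)}{x^2}\bigr)$. On $S^0=\{\pm1\}$ take counting measure $d\omega$ and weight $w_k(\omega)=|\alpha\omega|^{2k}$; $\operatorname{vol}_k(S^0)=\int_{S^0}w_k(\omega)\,d\omega$. On $\mathbb{R}$ the weight is $w_{k,0}(x)=|x|^{-2}|\alpha x|^{2k}$. $\mathcal{H}_k^m(S^0)$ is the space of restrictions to $S^0$ of homogeneous polynomials $p$ of degree $m$ on $\mathbb{R}$ with $\Delta_kp=0$. The Poisson kernel is $P_k^{(m)}(\omega,\omega')=\operatorname{vol}_k(S^0)\sum_{j}p_j(\omega)\overline{p_j(\omega')}$ for any orthonormal basis $(p_j)$ of $\mathcal{H}_k^m(S^0)\subset L^2(S^0,w_k(\omega)d\omega)$. For $\operatorname{Re}z>0$, $r,r'>0$, $\omega,\omega'\in S^0$, the kernel is defined by $$K_k(r\omega,r'\omega';z)=\frac{1}{\sqrt{4\pi z}}\exp\Bigl(-\frac{(\log r-\log r')^2}{4z}\Bigr)(rr')^{-\frac{2k-1}{2}}\cdot\frac{1}{\operatorname{vol}_k(S^0)}\sum_{m=0}^\infty\exp\Bigl(-z\Bigl(m+\frac{2k-1}{2}\Bigr)^2\Bigr)P_k^{(m)}(\omega,\omega');$$ it is the integral kernel, with respect to $w_{k,0}(x')\,dx'$, of the bounded operator $\exp(z|x|^2\Delta_k)$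 on $L^2(\mathbb{R},w_{k,0}(x)dx)$. *)

theory Defs
  imports "HOL-Analysis.Analysis" "HOL-Computational_Algebra.Polynomial"
begin

text \<open>
  Rank-one Dunkl setting for the root system consisting of \<open>\<alpha>\<close> and \<open>-\<alpha>\<close>, \<open>\<alpha> > 0\<close>; a multiplicity
  function is identified with its single value \<open>k \<ge> 0\<close>.
\<close>

definition S0 :: "real set" where
  "S0 = {-1, 1}"

definition dunkl_weight :: "real \<Rightarrow> real \<Rightarrow> real \<Rightarrow> real" where
  "dunkl_weight \<alpha> k \<omega> = \<bar>\<alpha> * \<omega>\<bar> powr (2 * k)"

definition dunkl_vol :: "real \<Rightarrow> real \<Rightarrow> real" where
  "dunkl_vol \<alpha> k = (LINT \<omega>|count_space S0. dunkl_weight \<alpha> k \<omega>)"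

text \<open>Meaningful only at \<open>x \<noteq> 0\<close>: at \<open>0\<close> the quotients take the junk value \<open>0\<close>.\<close>

definition dunkl_laplacian :: "real \<Rightarrow> (real \<Rightarrow> complex) \<Rightarrow> real \<Rightarrow> complex" where
  "dunkl_laplacian k F x =
     vector_derivative (\<lambda>y. vector_derivative F (at y)) (at x)
     + of_real k * (2 * vector_derivative F (at x) / of_real x
                    - (F x - F (- x)) / of_real (x\<^sup>2))"

definition homogeneous_poly :: "nat \<Rightarrow> complex poly \<Rightarrow> bool" where
  "homogeneous_poly m p \<longleftrightarrow> (\<forall>i. coeff p i \<noteq> 0 \<longrightarrow> i = m)"

text \<open>
  The equation \<open>\<Delta>\<^sub>k p = 0\<close> is imposed off the origin; as \<open>\<Delta>\<^sub>k p\<close> extends to a polynomial, this is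
  the same as its vanishing identically. Elements are extensional functions, so that two of them
  are equal as soon as they agree on \<open>S0\<close>.
\<close>

definition dunkl_harmonics :: "real \<Rightarrow> nat \<Rightarrow> (real \<Rightarrow> complex) set" where
  "dunkl_harmonics k m =
     {restrict (\<lambda>x. poly p (of_real x)) S0 | p.
        homogeneous_poly m p \<and>
        (\<forall>x. x \<noteq> 0 \<longrightarrow> dunkl_laplacian k (\<lambda>y. poly p (of_real y)) x = 0)}"

definition dunkl_inner :: "real \<Rightarrow> real \<Rightarrow> (real \<Rightarrow> complex) \<Rightarrow> (real \<Rightarrow> complex) \<Rightarrow> complex" where
  "dunkl_inner \<alpha> k f g =
     (LINT \<omega>|count_space S0. f \<omega> * cnj (g \<omega>) * of_real (dunkl_weight \<alpha> k \<omega>))"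

definition harmonic_onb :: "real \<Rightarrow> real \<Rightarrow> nat \<Rightarrow> (real \<Rightarrow> complex) set \<Rightarrow> bool" where
  "harmonic_onb \<alpha> k m B \<longleftrightarrow>
     finite B \<and> B \<subseteq> dunkl_harmonics k m \<and>
     (\<forall>p\<in>B. \<forall>q\<in>B. dunkl_inner \<alpha> k p q = (if p = q then 1 else 0)) \<and>
     (\<forall>f\<in>dunkl_harmonics k m. \<exists>c. \<forall>\<omega>\<in>S0. f \<omega> = (\<Sum>p\<in>B. c p * p \<omega>))"

text \<open>
  The description is proper for \<open>\<omega>, \<omega>' \<in> S0\<close>: an orthonormal basis exists and the sum does not
  depend on its choice.
\<close>

definition poisson_kernel :: "real \<Rightarrow> real \<Rightarrow> nat \<Rightarrow> real \<Rightarrow> real \<Rightarrow> complex" where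
  "poisson_kernel \<alpha> k m \<omega> \<omega>' =
     (THE c. \<forall>B. harmonic_onb \<alpha> k m B \<longrightarrow>
        c = of_real (dunkl_vol \<alpha> k) * (\<Sum>p\<in>B. p \<omega> * cnj (p \<omega>')))"

text \<open>
  The kernel of \<open>exp (z |x|\<^sup>2 \<Delta>\<^sub>k)\<close>, with polar coordinates \<open>x = r \<omega>\<close> given by \<open>r = \<bar>x\<bar>\<close> and
  \<open>\<omega> = sgn x\<close>; relevant for \<open>x, x' \<noteq> 0\<close> and \<open>Re z > 0\<close>.
\<close>

definition dunkl_kernel :: "real \<Rightarrow> real \<Rightarrow> real \<Rightarrow> real \<Rightarrow> complex \<Rightarrow> complex" where
  "dunkl_kernel \<alpha> k x x' z =
     (let r = \<bar>x\<bar>; \<omega> = sgn x; r' = \<bar>x'\<bar>; \<omega>' = sgn x' in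
        1 / csqrt (4 * of_real pi * z)
        * exp (- of_real ((ln r - ln r')\<^sup>2) / (4 * z))
        * of_real ((r * r') powr (- ((2 * k - 1) / 2)))
        * (1 / of_real (dunkl_vol \<alpha> k))
        * (\<Sum>m. exp (- z * of_real ((real m + (2 * k - 1) / 2)\<^sup>2)) * poisson_kernel \<alpha> k m \<omega> \<omega>'))"

end

theory Submission
  imports Defs
begin

text \<open>
  In degree \<open>m\<close> the Dunkl Laplacian multiplies \<open>x\<^sup>m\<close> by
  \<open>m (m - 1) + k (2 m - 1 + (-1)\<^sup>m)\<close> times \<open>x\<^sup>-\<^sup>2\<close>. For \<open>k \<ge> 0\<close> this factor vanishes only for
  \<open>m = 0\<close> and \<open>m = 1\<close>, so only the constants and the linear functions are harmonic and the series
  for the kernel reduces to its first two terms, with Poisson kernels \<open>1\<close> and \<open>\<omega> \<omega>'\<close>.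
\<close>

section \<open>Weight and total mass of the two-point sphere\<close>

lemma dunkl_weight_S0: "\<alpha> > 0 \<Longrightarrow> \<omega> \<in> S0 \<Longrightarrow> dunkl_weight \<alpha> k \<omega> = \<alpha> powr (2 * k)"
  by (auto simp: S0_def dunkl_weight_def abs_mult)

lemma dunkl_vol_eq: "\<alpha> > 0 \<Longrightarrow> dunkl_vol \<alpha> k = 2 * \<alpha> powr (2 * k)"
  unfolding dunkl_vol_def
  by (subst lebesgue_integral_count_space_finite)
     (auto simp: S0_def dunkl_weight_S0[unfolded S0_def])

section \<open>Homogeneous Dunkl harmonics on the line\<close>

lemma homogeneous_poly_iff: "homogeneous_poly m p \<longleftrightarrow> (\<exists>c. p = monom c m)"
proof
  assume "homogeneous_poly m p"
  then have "p = monom (coeff p m) m"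
    by (auto simp: homogeneous_poly_def poly_eq_iff)
  then show "\<exists>c. p = monom c m" ..
qed (auto simp: homogeneous_poly_def split: if_splits)

text \<open>The result is again a constant times a power, so the same rule rewrites second
  derivatives. At \<open>m = 0\<close> the truncated exponent \<open>m - 1\<close> is harmless
  because \<open>of_nat m\<close> vanishes.\<close>

lemma vector_derivative_monomial:
  "vector_derivative (\<lambda>y. c * of_real y ^ m :: complex) (at x) =
     c * of_nat m * of_real x ^ (m - 1)"
proof (rule vector_derivative_at)
  have "((\<lambda>y. c * y ^ m) has_field_derivative c * of_nat m * of_real x ^ (m - 1))
          (at (of_real x))"
    by (auto intro!: derivative_eq_intros)
  from has_vector_derivative_real_field[OF this]
  show "((\<lambda>y. c * of_real y ^ m) has_vector_derivative c * of_nat m * of_real x ^ (m - 1)) (at x)"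
    by simp
qed

text \<open>The reflection term contributes \<open>- 1 + (- 1) ^ m\<close> to the bracket. The
  quotient by \<open>of_real x ^ 2\<close> avoids a truncated exponent \<open>m - 2\<close>.\<close>

lemma dunkl_laplacian_monomial:
  assumes "x \<noteq> 0"
  shows "dunkl_laplacian k (\<lambda>y. c * of_real y ^ m) x =
     c * of_real (real m * (real m - 1) + k * (2 * real m - 1 + (- 1) ^ m)) *
     of_real x ^ m / of_real x ^ 2"
proof -
  \<comment> \<open>Differentiating twice produces the exponent \<open>m - 1 - 1\<close>, which is
    truncated exactly for \<open>m = 0\<close> and \<open>m = 1\<close>.\<close>
  consider "m = 0" | "m = 1" | n where "m = Suc (Suc n)"
    by (metis One_nat_def not0_implies_Suc)
  then show ?thesis
  proof cases
    case 3
    with assms show ?thesis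
      unfolding dunkl_laplacian_def vector_derivative_monomial
      \<comment> \<open>\<open>n\<close> has the parity of \<open>m\<close>, which decides whether
        the reflected value is \<open>F x\<close> or its negative.\<close>
      by (cases "even n") (simp_all add: field_simps power2_eq_square)
  qed (use assms in \<open>simp_all add: dunkl_laplacian_def vector_derivative_monomial
                       field_simps power2_eq_square\<close>)
qed

text \<open>From degree two on, the first summand is positive and the second nonnegative. At
  \<open>m = 0\<close> and \<open>m = 1\<close> the bracket is \<open>- 1 + 1\<close> and
  \<open>1 - 1\<close>.\<close>

lemma dunkl_laplacian_factor_eq_0_iff:
  fixes k :: real
  assumes "k \<ge> 0"
  shows "real m * (real m - 1) + k * (2 * real m - 1 + (- 1) ^ m) = 0 \<longleftrightarrow> m < 2"
proof (cases "m < 2")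
  case True
  then show ?thesis by (auto simp: less_2_cases_iff)
next
  case False
  then have "real m * (real m - 1) > 0" by simp
  moreover have "2 * real m - 1 + (- 1) ^ m \<ge> 0"
    using False by (cases "even m") auto
  with assms have "k * (2 * real m - 1 + (- 1) ^ m) \<ge> 0" by simp
  ultimately show ?thesis using False by linarith
qed

lemma dunkl_harmonics_eq:
  assumes "k \<ge> 0"
  shows "dunkl_harmonics k m =
     {restrict (\<lambda>x. c * of_real x ^ m) S0 | c. m < 2 \<or> c = 0}"
proof -
  have harmonic: "(\<forall>x. x \<noteq> 0 \<longrightarrow>
      dunkl_laplacian k (\<lambda>y. poly (monom c m) (of_real y)) x = 0) \<longleftrightarrow> m < 2 \<or> c = 0" for c
  proof -
    have "(\<forall>x. x \<noteq> 0 \<longrightarrow> dunkl_laplacian k (\<lambda>y. c * of_real y ^ m) x = 0)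
          \<longleftrightarrow> c = 0 \<or> real m * (real m - 1) + k * (2 * real m - 1 + (- 1) ^ m) = 0"
      \<comment> \<open>The point 1 makes the condition over nonzero \<open>x\<close> non-vacuous.
        The deleted rules keep the real factor under a single \<open>of_real\<close>, so its
        vanishing can be read off over the reals.\<close>
      using zero_neq_one[where 'a = real]
      by (auto simp: dunkl_laplacian_monomial simp del: of_real_add of_real_mult of_real_diff
          of_real_power)
    then show ?thesis
      unfolding poly_monom dunkl_laplacian_factor_eq_0_iff[OF assms] by blast
  qed
  have "dunkl_harmonics k m =
      {restrict (\<lambda>x. poly (monom c m) (of_real x)) S0 | c. m < 2 \<or> c = 0}"
    unfolding dunkl_harmonics_def homogeneous_poly_iff using harmonic by blast
  then show ?thesis by (simp add: poly_monom)
qed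

section \<open>Orthonormal bases of the harmonics\<close>

lemma dunkl_inner_monomials:
  assumes "\<alpha> > 0"
  shows "dunkl_inner \<alpha> k (restrict (\<lambda>x. c * of_real x ^ m) S0) (restrict (\<lambda>x. d * of_real x ^ m) S0)
     = c * cnj d * of_real (dunkl_vol \<alpha> k)"
  unfolding dunkl_inner_def
  \<comment> \<open>Both points contribute equally, as
    \<open>\<omega> ^ m * \<omega> ^ m = (\<omega> * \<omega>) ^ m = 1\<close>.\<close>
  by (subst lebesgue_integral_count_space_finite)
     (auto simp: S0_def dunkl_vol_eq assms dunkl_weight_S0[unfolded S0_def]
        power_mult_distrib[symmetric])

text \<open>In degrees zero and one the harmonics form a complex line spanned by
  \<open>x ^ m\<close>, so a basis is one unit vector; only the phase of \<open>c\<close> stays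
  free.\<close>

lemma harmonic_onb_iff:
  assumes "\<alpha> > 0" "k \<ge> 0" "m < 2"
  shows "harmonic_onb \<alpha> k m B \<longleftrightarrow>
    (\<exists>c. B = {restrict (\<lambda>x. c * of_real x ^ m) S0} \<and> c * cnj c * of_real (dunkl_vol \<alpha> k) = 1)"
    (is "?L \<longleftrightarrow> ?R")
proof
  define h where "h c = restrict (\<lambda>x. c * of_real x ^ m :: complex) S0" for c
  have harm: "dunkl_harmonics k m = range h"
    using assms by (auto simp: dunkl_harmonics_eq h_def)
  have inner: "dunkl_inner \<alpha> k (h c) (h d) = c * cnj d * of_real (dunkl_vol \<alpha> k)" for c d
    unfolding h_def by (rule dunkl_inner_monomials[OF assms(1)])
  {
    assume onb: ?L
    \<comment> \<open>The empty set spans only zero, whereas \<open>h 1\<close> is nonzero on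
      \<open>S0\<close>.\<close>
    have "B \<noteq> {}"
    proof
      assume "B = {}"
      then have "\<forall>\<omega>\<in>S0. h 1 \<omega> = 0"
        using onb harm by (auto simp: harmonic_onb_def)
      then show False by (auto simp: h_def S0_def)
    qed
    moreover have sub: "B \<subseteq> range h"
      using onb harm by (auto simp: harmonic_onb_def)
    ultimately obtain c where c: "h c \<in> B" by blast
    have norm: "d * cnj d * of_real (dunkl_vol \<alpha> k) = 1" if "h d \<in> B" for d
      using onb that inner[of d d] by (auto simp: harmonic_onb_def)
    have "q = h c" if q: "q \<in> B" for q
    proof (rule ccontr)
      assume "q \<noteq> h c"
      moreover obtain d where d: "q = h d" using sub q by blast
      \<comment> \<open>Orthogonality contradicts the normalizations, which make \<open>c\<close>,
        \<open>d\<close> and the volume nonzero.\<close>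
      ultimately have "c * cnj d * of_real (dunkl_vol \<alpha> k) = 0"
        using onb c q inner[of c d] unfolding harmonic_onb_def by metis
      with norm[OF c] norm[of d] q d show False by auto
    qed
    with c have "B = {h c}" by blast
    with norm[OF c] show ?R unfolding h_def by blast
  next
    assume ?R
    then obtain c where B: "B = {h c}" and c: "c * cnj c * of_real (dunkl_vol \<alpha> k) = 1"
      unfolding h_def by blast
    have "c \<noteq> 0" using c by auto
    then have "\<exists>a. \<forall>\<omega>\<in>S0. h d \<omega> = (\<Sum>p\<in>B. a p * p \<omega>)" for d
      by (intro exI[of _ "\<lambda>_. d / c"]) (auto simp: B h_def)
    then show ?L
      unfolding harmonic_onb_def harm using B c inner by auto
  }
qed

section \<open>Poisson kernels in every degree\<close>

lemma poisson_kernel_eq: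
  assumes "\<alpha> > 0" "k \<ge> 0" "\<omega> \<in> S0" "\<omega>' \<in> S0"
  shows "poisson_kernel \<alpha> k m \<omega> \<omega>' = (if m < 2 then of_real (\<omega> * \<omega>') ^ m else 0)"
proof -
  \<comment> \<open>Without any basis the condition under \<open>THE\<close> would hold vacuously
    for every value, so existence is settled before independence of the choice.\<close>
  obtain B0 where B0: "harmonic_onb \<alpha> k m B0"
  proof (cases "m < 2")
    case True
    have "dunkl_vol \<alpha> k > 0" using assms by (simp add: dunkl_vol_eq)
    then have "complex_of_real (1 / sqrt (dunkl_vol \<alpha> k)) *
        cnj (of_real (1 / sqrt (dunkl_vol \<alpha> k))) * of_real (dunkl_vol \<alpha> k) = 1"
      by (simp flip: of_real_mult)
    with harmonic_onb_iff[OF assms(1,2) True] that show ?thesis by blast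
  next
    case False
    then have "harmonic_onb \<alpha> k m {}"
      using assms by (auto simp: harmonic_onb_def dunkl_harmonics_eq)
    then show ?thesis by (rule that)
  qed
  have onb_sum: "of_real (dunkl_vol \<alpha> k) * (\<Sum>p\<in>B. p \<omega> * cnj (p \<omega>')) =
      (if m < 2 then of_real (\<omega> * \<omega>') ^ m else 0)" if onb: "harmonic_onb \<alpha> k m B" for B
  proof (cases "m < 2")
    case True
    then obtain c where B: "B = {restrict (\<lambda>x. c * of_real x ^ m) S0}"
      and c: "c * cnj c * of_real (dunkl_vol \<alpha> k) = 1"
      using onb harmonic_onb_iff[OF assms(1,2)] by blast
    \<comment> \<open>Regrouping isolates the normalization of \<open>c\<close>, so its phase drops
      out.\<close>
    have "of_real (dunkl_vol \<alpha> k) * (\<Sum>p\<in>B. p \<omega> * cnj (p \<omega>')) =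
        (c * cnj c * of_real (dunkl_vol \<alpha> k)) * of_real (\<omega> * \<omega>') ^ m"
      using assms(3,4) by (simp add: B power_mult_distrib)
    with c True show ?thesis by simp
  next
    case False
    \<comment> \<open>The only candidate is the zero function, whose squared norm is 0 and not
      1.\<close>
    have "p \<notin> B" for p
    proof
      assume p: "p \<in> B"
      then have "p = restrict (\<lambda>x. 0 * of_real x ^ m) S0"
        using onb assms(2) False by (auto simp: harmonic_onb_def dunkl_harmonics_eq)
      then have "dunkl_inner \<alpha> k p p = 0"
        using dunkl_inner_monomials[OF assms(1), of k 0 m 0] by simp
      with onb p show False by (auto simp: harmonic_onb_def)
    qed
    then have "B = {}" by blast
    with False show ?thesis by simp
  qed
  show ?thesis
    unfolding poisson_kernel_def
  proof (rule the_equality)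
    fix c
    assume "\<forall>B. harmonic_onb \<alpha> k m B \<longrightarrow>
      c = of_real (dunkl_vol \<alpha> k) * (\<Sum>p\<in>B. p \<omega> * cnj (p \<omega>'))"
    with B0 have "c = of_real (dunkl_vol \<alpha> k) * (\<Sum>p\<in>B0. p \<omega> * cnj (p \<omega>'))" by blast
    then show "c = (if m < 2 then of_real (\<omega> * \<omega>') ^ m else 0)"
      unfolding onb_sum[OF B0] .
  qed (intro allI impI onb_sum[symmetric])
qed

section \<open>Summation of the series for the kernel\<close>

lemma dunkl_kernel_eq:
  assumes "\<alpha> > 0" "k \<ge> 0" "x \<noteq> 0" "x' \<noteq> 0"
  shows "dunkl_kernel \<alpha> k x x' z =
    1 / (2 * of_real (\<alpha> powr (2 * k)) * csqrt (4 * of_real pi * z))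
    * exp (- of_real ((ln (abs x) - ln (abs x'))\<^sup>2) / (4 * z))
    * of_real (\<bar>x * x'\<bar> powr (- k + 1 / 2))
    * (exp (- of_real ((k - 1 / 2)\<^sup>2) * z)
       + exp (- of_real ((k + 1 / 2)\<^sup>2) * z) * of_real (sgn (x * x')))"
proof -
  have S0: "sgn x \<in> S0" "sgn x' \<in> S0"
    using assms by (auto simp: S0_def sgn_if)
  define a where "a m = exp (- z * of_real ((real m + (2 * k - 1) / 2)\<^sup>2)) *
    poisson_kernel \<alpha> k m (sgn x) (sgn x')" for m
  have "(\<Sum>m. a m) = (\<Sum>m<2. a m)"
    by (rule suminf_finite) (auto simp: a_def poisson_kernel_eq[OF assms(1,2) S0])
  also have "\<dots> = exp (- z * of_real ((0 + (2 * k - 1) / 2)\<^sup>2)) +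
      exp (- z * of_real ((1 + (2 * k - 1) / 2)\<^sup>2)) * of_real (sgn (x * x'))"
    by (simp add: a_def poisson_kernel_eq[OF assms(1,2) S0] numeral_2_eq_2 sgn_mult)
  also have "0 + (2 * k - 1) / 2 = k - 1 / 2" by (simp add: field_simps)
  also have "1 + (2 * k - 1) / 2 = k + 1 / 2" by (simp add: field_simps)
  finally have series: "(\<Sum>m. a m) = exp (- of_real ((k - 1 / 2)\<^sup>2) * z)
      + exp (- of_real ((k + 1 / 2)\<^sup>2) * z) * of_real (sgn (x * x'))"
    by (simp add: mult.commute)
  have exponent: "- ((2 * k - 1) / 2) = - k + 1 / 2" by (simp add: field_simps)
  show ?thesis
    unfolding dunkl_kernel_def Let_def a_def[symmetric] series exponent dunkl_vol_eq[OF assms(1)]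
      abs_mult
    by simp
qed

theorem proposition4p1:
  fixes \<alpha> k :: real and z :: complex
  assumes "\<alpha> > 0" and "k \<ge> 0" and "Re z > 0"
  shows "(\<forall>x x'. x \<noteq> 0 \<longrightarrow> x' \<noteq> 0 \<longrightarrow>
            dunkl_kernel \<alpha> k x x' z =
              1 / (2 * of_real (\<alpha> powr (2 * k)) * csqrt (4 * of_real pi * z))
              * exp (- of_real ((ln \<bar>x\<bar> - ln \<bar>x'\<bar>)\<^sup>2) / (4 * z))
              * of_real (\<bar>x * x'\<bar> powr (- k + 1 / 2))
              * (exp (- of_real ((k - 1 / 2)\<^sup>2) * z)
                 + exp (- of_real ((k + 1 / 2)\<^sup>2) * z) * of_real (sgn (x * x'))))
       \<and> (\<forall>x x'. x \<noteq> 0 \<longrightarrow> x' \<noteq> 0 \<longrightarrow>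
            dunkl_kernel \<alpha> 0 x x' z =
              exp (- z / 4) / (2 * csqrt (4 * of_real pi * z))
              * exp (- of_real ((ln \<bar>x\<bar> - ln \<bar>x'\<bar>)\<^sup>2) / (4 * z))
              * of_real (\<bar>x * x'\<bar> powr (1 / 2))
              * (1 + of_real (sgn (x * x'))))"
proof (intro conjI allI impI)
  fix x x' :: real
  assume nz: "x \<noteq> 0" "x' \<noteq> 0"
  show "dunkl_kernel \<alpha> k x x' z =
          1 / (2 * of_real (\<alpha> powr (2 * k)) * csqrt (4 * of_real pi * z))
          * exp (- of_real ((ln (abs x) - ln (abs x'))\<^sup>2) / (4 * z))
          * of_real (\<bar>x * x'\<bar> powr (- k + 1 / 2))
          * (exp (- of_real ((k - 1 / 2)\<^sup>2) * z)
             + exp (- of_real ((k + 1 / 2)\<^sup>2) * z) * of_real (sgn (x * x')))"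
    using assms nz by (intro dunkl_kernel_eq)
  \<comment> \<open>At \<open>k = 0\<close> both decay rates equal 1/4, so the common exponential
    can be pulled out of the sum.\<close>
  have exponents: "- of_real ((0 - 1 / 2)\<^sup>2) * z = - z / 4" "- of_real ((0 + 1 / 2)\<^sup>2) * z = - z / 4"
    by (simp_all add: power2_eq_square)
  have "dunkl_kernel \<alpha> 0 x x' z =
          1 / (2 * csqrt (4 * of_real pi * z))
          * exp (- of_real ((ln (abs x) - ln (abs x'))\<^sup>2) / (4 * z))
          * of_real (\<bar>x * x'\<bar> powr (1 / 2))
          * (exp (- z / 4) + exp (- z / 4) * of_real (sgn (x * x')))"
    unfolding dunkl_kernel_eq[OF assms(1) order_refl nz] exponents
    using assms(1) by simp
  also have "\<dots> = exp (- z / 4) / (2 * csqrt (4 * of_real pi * z))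
          * exp (- of_real ((ln (abs x) - ln (abs x'))\<^sup>2) / (4 * z))
          * of_real (\<bar>x * x'\<bar> powr (1 / 2))
          * (1 + of_real (sgn (x * x')))"
    by (simp only: divide_inverse distrib_left distrib_right mult_1_left mult_1_right mult_ac)
  finally show "dunkl_kernel \<alpha> 0 x x' z = \<dots>" .
qed

end
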